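(* Let $p\ge 3$ be an integer, and let $\phi$ and $\phi^{(m)}$ be the functionals on the $p$-adic group defined in the context, with $\pi_m(j)=\lambda(\phi^{(m)}=j)$, so that $P_m^p(t)=\sum_{j}\pi_m(j)t^j$. Then the polynomials $P_m^p$ have the palindromic property: for every integer $m\ge 0$ and every integer $j$ with $0\le j\le m(p-2)$, $$\pi_m(j)=\pi_m\big(m(p-2)-j\big).$$
   Context: Let $p\ge 3$ be an integer (not necessarily prime). $\Gamma=\{x=(x_0,x_1,x_2,\ldots): x_k\in\{0,1,\ldots,p-1\}\}$ is the compact group of $p$-adic integers (addition with carry to the right), and $\lambda$ is its Haar probability measure; under $\lambda$ the coordinates $x_k$ are i.i.d. uniform on $\{0,\ldots,p-1\}$. $\Gamma'=\Gamma\setminus\{(p-1,p-1,\ldots)\}$. $S:x\mapsto x+1$ with $1=(1,0,0,\ldots)$. For $x\in\Gamma'$, $\phi(x)$ is the first coordinate of $x$ different from $p-1$, i.e. $\phi(x)=x_i$ if $x=(p-1,\ldots,p-1,x_i,x_{i+1},\ldots)$ with $x_i\neq p-1$. Put $\phi^{(0)}=0$ and $\phi^{(m)}(x)=\phi(x)+\phi(Sx)+\cdots+\phi(S^{m-1}x)$ for $m\ge1$; this is defined for $\lambda$-almost every $x$ (outside the countable set of $x$ with $S^jx\notin\Gamma'$ for some $j$). Put $\pi_m(j)=\lambda(\phi^{(m)}=j)$ for $j\in\mathbb Z$, and $P_m^p(t)=\mathbb E_\lambda[t^{\phi^{(m)}(x)}]=\sum_j \pi_m(j)t^j$. Palindromic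 property of a functional $\phi$: with $\phi_\star=\min\phi$, $\phi^\star=\max\phi$, $\delta=\phi^\star-\phi_\star$, one has $\pi_m(m\phi_\star+j)=\pi_m(m\phi^\star-j)$ for all $0\le j\le m\delta$. Here $\phi_\star=0$ and $\phi^\star=p-2$. *)

theory Defs
  imports "HOL-Probability.Probability"
begin

text \<open>Here \<open>p\<close> need not be prime. An element of \<open>\<Gamma>\<close> is its digit sequence, least significant digit first.\<close>

definition padics :: "nat \<Rightarrow> (nat \<Rightarrow> nat) set" where
  "padics p = {x. \<forall>k. x k < p}"

definition padics' :: "nat \<Rightarrow> (nat \<Rightarrow> nat) set" where
  "padics' p = padics p - {\<lambda>_. p - 1}"

text \<open>The Haar probability measure \<open>\<lambda>\<close>, given as the law under which the digits are i.i.d. uniform.\<close>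

definition haar :: "nat \<Rightarrow> (nat \<Rightarrow> nat) measure" where
  "haar p = (\<Pi>\<^sub>M k\<in>UNIV. uniform_count_measure {..<p})"

lemma space_haar: "space (haar p) = padics p"
  by (auto simp: haar_def padics_def space_PiM space_uniform_count_measure PiE_def Pi_def extensional_def)

primrec carry :: "nat \<Rightarrow> (nat \<Rightarrow> nat) \<Rightarrow> (nat \<Rightarrow> nat) \<Rightarrow> nat \<Rightarrow> nat" where
  "carry p x y 0 = 0"
| "carry p x y (Suc k) = (x k + y k + carry p x y k) div p"

definition padic_add :: "nat \<Rightarrow> (nat \<Rightarrow> nat) \<Rightarrow> (nat \<Rightarrow> nat) \<Rightarrow> nat \<Rightarrow> nat" where
  "padic_add p x y = (\<lambda>k. (x k + y k + carry p x y k) mod p)"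

definition padic_one :: "nat \<Rightarrow> nat" where
  "padic_one = (\<lambda>k. if k = 0 then 1 else 0)"

definition S :: "nat \<Rightarrow> (nat \<Rightarrow> nat) \<Rightarrow> (nat \<Rightarrow> nat)" where
  "S p x = padic_add p x padic_one"

text \<open>Meaningful on \<open>padics' p\<close> only; at the excluded point the value is irrelevant.\<close>

definition phi :: "nat \<Rightarrow> (nat \<Rightarrow> nat) \<Rightarrow> nat" where
  "phi p x = x (LEAST i. x i \<noteq> p - 1)"

definition phi_sum :: "nat \<Rightarrow> nat \<Rightarrow> (nat \<Rightarrow> nat) \<Rightarrow> nat" where
  "phi_sum p m x = (\<Sum>k<m. phi p ((S p ^^ k) x))"

definition phi_sum_dom :: "nat \<Rightarrow> nat \<Rightarrow> (nat \<Rightarrow> nat) set" where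
  "phi_sum_dom p m = {x \<in> padics p. \<forall>k<m. (S p ^^ k) x \<in> padics' p}"

text \<open>\<open>\<pi>\<^sub>m(j)\<close>, for every integer \<open>j\<close>.\<close>

definition phi_prob :: "nat \<Rightarrow> nat \<Rightarrow> int \<Rightarrow> real" where
  "phi_prob p m j = measure (haar p) {x \<in> phi_sum_dom p m. int (phi_sum p m x) = j}"

text \<open>\<open>P\<^sub>m\<^sup>p(t)\<close>; the complement of \<open>phi_sum_dom p m\<close> is a finite set, hence negligible for \<open>p \<ge> 2\<close>.\<close>

definition phi_gf :: "nat \<Rightarrow> nat \<Rightarrow> real \<Rightarrow> real" where
  "phi_gf p m t = (LINT x|haar p. t ^ phi_sum p m x)"

end

theory Submission imports Defs begin

text \<open>
  Passing from \<open>y = (p-1, \<dots>, p-1, y\<^sub>i, \<dots>)\<close> to \<open>-y - 2\<close> replaces the first digit \<open>y\<^sub>i \<noteq> p-1\<close> by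
  \<open>p-2-y\<^sub>i\<close> and keeps the leading digits \<open>p-1\<close>, so \<open>\<phi>(-y-2) = p-2-\<phi>(y)\<close>. The reflection
  \<open>R x = -x-m-1\<close> satisfies \<open>S\<^sup>k (R x) = -(S\<^bsup>m-1-k\<^esup> x) - 2\<close>, hence
  \<open>\<phi>\<^sup>(\<^sup>m\<^sup>)(R x) = m(p-2) - \<phi>\<^sup>(\<^sup>m\<^sup>)(x)\<close>. As \<open>R\<close> is an involution whose first \<open>n\<close> output digits depend
  only on the first \<open>n\<close> input digits, it permutes the cylinders of each length and so preserves
  the Haar measure.
\<close>

section \<open>Cylinders and digit-causal maps\<close>

text \<open>Length 0 gives the whole space, and an out-of-range digit of \<open>y\<close> below
  \<open>n\<close> gives the empty set, so \<open>cylinders p\<close> contains both.\<close>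

definition cylinder :: "nat \<Rightarrow> nat \<Rightarrow> (nat \<Rightarrow> nat) \<Rightarrow> (nat \<Rightarrow> nat) set" where
  "cylinder p n y = {x \<in> padics p. \<forall>k<n. x k = y k}"

definition cylinders :: "nat \<Rightarrow> (nat \<Rightarrow> nat) set set" where
  "cylinders p = {cylinder p n y |n y. True}"

text \<open>These are the maps that descend to the residues modulo p^n for every n, in other words
  the 1-Lipschitz maps for the p-adic metric.\<close>

definition causal :: "nat \<Rightarrow> ((nat \<Rightarrow> nat) \<Rightarrow> (nat \<Rightarrow> nat)) \<Rightarrow> bool" where
  "causal p T \<longleftrightarrow> (\<forall>x\<in>padics p. T x \<in> padics p) \<and>
     (\<forall>x\<in>padics p. \<forall>y\<in>padics p. \<forall>n. (\<forall>k<n. x k = y k) \<longrightarrow> (\<forall>k<n. T x k = T y k))"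

lemma causalD:
  assumes "causal p T" "x \<in> padics p"
  shows causal_closed: "T x \<in> padics p"
    and causal_cong: "\<lbrakk>y \<in> padics p; \<And>k. k < n \<Longrightarrow> x k = y k; k < n\<rbrakk> \<Longrightarrow> T x k = T y k"
  using assms unfolding causal_def by blast+

lemma causal_comp:
  assumes T: "causal p T" and U: "causal p U"
  shows "causal p (\<lambda>x. T (U x))"
  unfolding causal_def
proof (intro conjI ballI allI impI)
  fix x assume x: "x \<in> padics p"
  then show "T (U x) \<in> padics p" by (intro causal_closed[OF T] causal_closed[OF U])
  fix y and n k :: nat assume y: "y \<in> padics p" and eq: "\<forall>k<n. x k = y k" and "k < n"
  have "U x i = U y i" if "i < n" for i
    using causal_cong[OF U x y, of n i] eq that by simp
  then show "T (U x) k = T (U y) k"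
    using causal_cong[OF T causal_closed[OF U x] causal_closed[OF U y]] \<open>k < n\<close> by blast
qed

lemma causal_funpow: "causal p T \<Longrightarrow> causal p (T ^^ n)"
proof (induction n)
  case 0
  then show ?case by (simp add: causal_def)
next
  case (Suc n)
  then show ?case using causal_comp[of p T "T ^^ n"] by (simp add: comp_def)
qed

lemma cylinders_subset: "cylinders p \<subseteq> Pow (padics p)"
  by (auto simp: cylinders_def cylinder_def)

lemma cylinder_eqI: "z \<in> cylinder p n y \<Longrightarrow> cylinder p n y = cylinder p n z"
  by (auto simp: cylinder_def)

text \<open>Two cylinders that meet are nested, and any common point can serve as centre of the
  longer one.\<close>

lemma Int_stable_cylinders: "Int_stable (cylinders p)"
proof (rule Int_stableI)
  fix a b assume "a \<in> cylinders p" "b \<in> cylinders p"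
  then obtain n y m z where ab: "a = cylinder p n y" "b = cylinder p m z"
    by (auto simp: cylinders_def)
  show "a \<inter> b \<in> cylinders p"
  proof (cases "a \<inter> b = {}")
    case True
    have "cylinder p 1 (\<lambda>_. p) = {}"
      by (auto simp: cylinder_def padics_def)
    then show ?thesis
      unfolding True cylinders_def by blast
  next
    case False
    then obtain w where "w \<in> a \<inter> b" by auto
    then have "a \<inter> b = cylinder p (max n m) w"
      by (auto simp: ab cylinder_def less_max_iff_disj)
    then show ?thesis by (auto simp: cylinders_def)
  qed
qed

text \<open>Such a \<open>B\<close> is the union of the length-\<open>n\<close> cylinders around its
  points, and there are only countably many cylinders of length \<open>n\<close>.\<close>

lemma finite_determined_in_sigma_cylinders:
  assumes "B \<subseteq> padics p"
    and "\<And>x y. \<lbrakk>x \<in> B; y \<in> padics p; \<And>k. k < n \<Longrightarrow> x k = y k\<rbrakk> \<Longrightarrow> y \<in> B"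
  shows "B \<in> sigma_sets (padics p) (cylinders p)"
proof -
  interpret sigma_algebra "padics p" "sigma_sets (padics p) (cylinders p)"
    by (rule sigma_algebra_sigma_sets[OF cylinders_subset])
  have eq: "B = (\<Union>x\<in>B. cylinder p n x)"
  proof
    show "B \<subseteq> (\<Union>x\<in>B. cylinder p n x)"
      using assms(1) by (auto simp: cylinder_def)
    show "(\<Union>x\<in>B. cylinder p n x) \<subseteq> B"
    proof
      fix y assume "y \<in> (\<Union>x\<in>B. cylinder p n x)"
      then obtain x where "x \<in> B" "y \<in> padics p" "\<forall>k<n. y k = x k"
        by (auto simp: cylinder_def)
      then show "y \<in> B" using assms(2)[of x y] by simp
    qed
  qed
  \<comment> \<open>Only the digits below \<open>n\<close> matter, so lists of naturals, a countable
    type, index all cylinders of length \<open>n\<close>.\<close>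
  have "cylinder p n x \<in> range (\<lambda>l. cylinder p n (\<lambda>k. l ! k))" for x
    by (rule image_eqI[of _ _ "map x [0..<n]"]) (auto simp: cylinder_def)
  then have "cylinder p n ` B \<subseteq> range (\<lambda>l. cylinder p n (\<lambda>k. l ! k))"
    by blast
  then have "countable (cylinder p n ` B)"
    by (rule countable_subset) simp
  then have "\<Union> (cylinder p n ` B) \<in> sigma_sets (padics p) (cylinders p)"
    by (rule countable_Union) (auto simp: cylinders_def)
  then show ?thesis using eq by simp
qed

lemma digit_in_sigma_cylinders: "{x \<in> padics p. x k \<in> A} \<in> sigma_sets (padics p) (cylinders p)"
proof (rule finite_determined_in_sigma_cylinders[where n = "Suc k"])
  fix x y assume "x \<in> {x \<in> padics p. x k \<in> A}" "y \<in> padics p" "\<And>i. i < Suc k \<Longrightarrow> x i = y i"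
  from this(1,2) this(3)[of k] show "y \<in> {x \<in> padics p. x k \<in> A}" by simp
qed auto

section \<open>The Haar measure on cylinders\<close>

text \<open>Intersecting with \<open>{..<p}\<close> makes every factor a measurable set of digits
  even where \<open>y k\<close> is out of range.\<close>

lemma cylinder_emb:
  "cylinder p n y = prod_emb UNIV (\<lambda>_. uniform_count_measure {..<p}) {..<n} (\<Pi>\<^sub>E k\<in>{..<n}. {y k} \<inter> {..<p})"
  by (auto simp: cylinder_def padics_def prod_emb_def PiE_def Pi_def extensional_def
      space_PiM space_uniform_count_measure)

lemma prob_space_digit: "(p::nat) > 0 \<Longrightarrow> prob_space (uniform_count_measure {..<p})"
  by (rule prob_space_uniform_count_measure) auto

lemma prob_space_haar: "p > 0 \<Longrightarrow> prob_space (haar p)"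
  unfolding haar_def by (intro prob_space_PiM prob_space_digit)

text \<open>The product sigma-algebra is generated by conditions on a single digit, and these are
  determined by finitely many digits.\<close>

lemma sets_haar: "sets (haar p) = sigma_sets (padics p) (cylinders p)"
proof
  show "sigma_sets (padics p) (cylinders p) \<subseteq> sets (haar p)"
  proof (rule sets.sigma_sets_subset[of _ "haar p", unfolded space_haar], clarsimp simp: cylinders_def)
    show "cylinder p n y \<in> sets (haar p)" for n y
      unfolding cylinder_emb haar_def
      by (rule sets_PiM_I) (auto simp: sets_uniform_count_measure)
  qed
  have "space (haar p) = (\<Pi>\<^sub>E i\<in>UNIV. space (uniform_count_measure {..<p}))"
    by (simp add: haar_def space_PiM)
  then have space: "(\<Pi>\<^sub>E i\<in>UNIV. space (uniform_count_measure {..<p})) = padics p"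
    by (simp add: space_haar)
  show "sets (haar p) \<subseteq> sigma_sets (padics p) (cylinders p)"
    unfolding haar_def sets_PiM_single space
    by (rule sigma_sets_mono) (auto intro: digit_in_sigma_cylinders)
qed

text \<open>What matters for invariance is that the value depends on the length alone, not on the
  centre.\<close>

lemma emeasure_cylinder:
  assumes "y \<in> padics p"
  shows "emeasure (haar p) (cylinder p n y) = ennreal ((1 / p) ^ n)"
proof -
  have p: "p > 0" using assms by (auto simp: padics_def)
  interpret product_prob_space "\<lambda>_. uniform_count_measure {..<p}" "UNIV :: nat set"
    by (simp add: product_prob_space_def product_prob_space_axioms_def product_sigma_finite_def
        prob_space_digit p prob_space_imp_sigma_finite)
  have y: "{y k} \<inter> {..<p} = {y k}" for k
    using assms by (auto simp: padics_def)
  have "emeasure (haar p) (cylinder p n y)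
      = (\<Prod>k<n. emeasure (uniform_count_measure {..<p}) {y k})"
    unfolding cylinder_emb haar_def y
    using assms by (intro emeasure_PiM_emb) (auto simp: sets_uniform_count_measure padics_def)
  also have "\<dots> = (\<Prod>k<n. ennreal (1 / p))"
    using assms by (intro prod.cong) (auto simp: emeasure_uniform_count_measure padics_def)
  also have "\<dots> = ennreal ((1 / p) ^ n)"
    by (simp add: prod_ennreal[symmetric] ennreal_power)
  finally show ?thesis .
qed

section \<open>Invariance of the measure and null points\<close>

lemma causal_vimage_cylinder:
  assumes "causal p T"
  shows "T -` cylinder p n y \<inter> padics p \<in> sets (haar p)"
  unfolding sets_haar
proof (rule finite_determined_in_sigma_cylinders[where n = n])
  fix x z assume "x \<in> T -` cylinder p n y \<inter> padics p" "z \<in> padics p" "\<And>k. k < n \<Longrightarrow> x k = z k"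
  then show "z \<in> T -` cylinder p n y \<inter> padics p"
    using causal_cong[OF assms, of x z n] causal_closed[OF assms, of z] by (auto simp: cylinder_def)
qed auto

lemma measurable_causal:
  assumes "causal p T"
  shows "T \<in> measurable (haar p) (haar p)"
  by (rule measurable_sigma_sets[OF sets_haar cylinders_subset])
    (use assms causal_closed causal_vimage_cylinder in \<open>auto simp: cylinders_def space_haar\<close>)

text \<open>Since \<open>T\<close> is its own inverse, the preimage of a cylinder around
  \<open>z\<close> is the cylinder of equal length around \<open>T z\<close>. The two measures thus
  agree on an intersection-stable generator.\<close>

lemma distr_haar_causal_involution:
  assumes "p > 0" and T: "causal p T" and inv: "\<And>x. x \<in> padics p \<Longrightarrow> T (T x) = x"
  shows "distr (haar p) (haar p) T = haar p"
proof (rule sym, rule measure_eqI_generator_eq[OF Int_stable_cylinders cylinders_subset])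
  interpret prob_space "haar p" by (rule prob_space_haar) fact
  fix X assume "X \<in> cylinders p"
  then obtain n y where X: "X = cylinder p n y" by (auto simp: cylinders_def)
  have "X \<in> sets (haar p)"
    using \<open>X \<in> cylinders p\<close> by (auto simp: sets_haar)
  then have eq: "emeasure (distr (haar p) (haar p) T) X = emeasure (haar p) (T -` X \<inter> padics p)"
    by (subst emeasure_distr) (auto simp: measurable_causal T space_haar)
  show "emeasure (haar p) X = emeasure (distr (haar p) (haar p) T) X"
  proof (cases "X = {}")
    case False
    \<comment> \<open>Recentring at a member provides a point of \<open>padics p\<close>, where
      causality and \<open>inv\<close> apply; \<open>y\<close> itself may lie outside.\<close>
    then obtain z where z: "z \<in> X" by auto
    then have zp: "z \<in> padics p" by (auto simp: X cylinder_def)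
    have Xz: "X = cylinder p n z" using z X cylinder_eqI by blast
    have "T -` X \<inter> padics p = cylinder p n (T z)"
    proof (intro set_eqI iffI)
      fix x assume x: "x \<in> T -` X \<inter> padics p"
      then have "T (T x) k = T z k" if "k < n" for k
        using that zp by (intro causal_cong[OF T, of "T x" z n]) (auto simp: Xz cylinder_def)
      with x show "x \<in> cylinder p n (T z)" by (simp add: cylinder_def inv)
    next
      fix x assume x: "x \<in> cylinder p n (T z)"
      then have "T x k = T (T z) k" if "k < n" for k
        using that causal_closed[OF T zp]
        by (intro causal_cong[OF T, of x "T z" n]) (auto simp: cylinder_def)
      with x zp show "x \<in> T -` X \<inter> padics p"
        by (simp add: Xz cylinder_def inv causal_closed[OF T])
    qed
    then show ?thesis
      using eq emeasure_cylinder[OF zp, of n] emeasure_cylinder[OF causal_closed[OF T zp], of n]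
      by (simp add: Xz)
  qed simp
next
  interpret prob_space "haar p" by (rule prob_space_haar) fact
  show "range (\<lambda>_::nat. padics p) \<subseteq> cylinders p"
  proof -
    have "padics p = cylinder p 0 (\<lambda>_. 0)" by (simp add: cylinder_def)
    then show ?thesis unfolding cylinders_def by blast
  qed
  show "emeasure (haar p) (padics p) \<noteq> \<infinity>"
    using emeasure_space_1 by (simp add: space_haar)
qed (auto simp: sets_haar)

text \<open>The point lies in cylinders of measure (1/p)^n for all n, which tends to 0 once
  \<open>p \<ge> 2\<close>; for p = 1 the space is a single atom.\<close>

lemma AE_haar_neq:
  assumes "p \<ge> 2"
  shows "AE x in haar p. x \<noteq> a"
proof (cases "a \<in> padics p")
  case True
  interpret prob_space "haar p" using assms by (intro prob_space_haar) simp
  have "cylinder p n a \<in> sets (haar p)" for n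
    by (auto simp: sets_haar cylinders_def)
  moreover have "{a} = (\<Inter>n. cylinder p n a)"
    using True by (auto simp: cylinder_def)
  ultimately have a: "{a} \<in> sets (haar p)" by auto
  have le: "measure (haar p) {a} \<le> (1 / p) ^ n" for n
  proof -
    have "measure (haar p) {a} \<le> measure (haar p) (cylinder p n a)"
      using True by (intro finite_measure_mono) (auto simp: cylinder_def sets_haar cylinders_def)
    also have "\<dots> = (1 / p) ^ n"
      by (simp add: measure_def emeasure_cylinder[OF True])
    finally show ?thesis .
  qed
  have "(\<lambda>n. (1 / real p) ^ n) \<longlonglongrightarrow> 0"
    using assms by (intro LIMSEQ_power_zero) auto
  then have "measure (haar p) {a} \<le> 0"
    by (rule LIMSEQ_le_const) (use le in auto)
  then have "{a} \<in> null_sets (haar p)"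
    using a by (simp add: null_sets_def emeasure_eq_measure measure_le_0_iff)
  then show ?thesis
    by (auto dest: AE_not_in)
next
  case False
  then show ?thesis by (intro AE_I2) (auto simp: space_haar)
qed

section \<open>The odometer, the complement and \<open>phi\<close>\<close>

text \<open>The digitwise complement of \<open>x\<close> is \<open>-x-1\<close>.\<close>

definition complement :: "nat \<Rightarrow> (nat \<Rightarrow> nat) \<Rightarrow> (nat \<Rightarrow> nat)" where
  "complement p x = (\<lambda>k. p - 1 - x k)"

lemma causal_complement: "p > 0 \<Longrightarrow> causal p (complement p)"
  by (auto simp: causal_def complement_def padics_def)

lemma complement_complement:
  assumes "x \<in> padics p"
  shows "complement p (complement p x) = x"
proof
  fix k
  have "x k < p" using assms by (simp add: padics_def)
  then show "complement p (complement p x) k = x k" by (simp add: complement_def)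
qed

text \<open>Position 0 is excluded because the condition holds vacuously there while the carry is
  0.\<close>

lemma carry_one:
  assumes "x \<in> padics p" "p \<ge> 2" "k > 0"
  shows "carry p x padic_one k = (if \<forall>i<k. x i = p - 1 then 1 else 0)"
  using \<open>k > 0\<close>
proof (induction k)
  case (Suc k)
  have xk: "x k < p" using assms by (auto simp: padics_def)
  show ?case
  \<comment> \<open>The unit entering position 0 is the digit of \<open>padic_one\<close>; at later
    positions it can only be a carry.\<close>
  proof (cases "k = 0")
    case True
    with xk assms show ?thesis
      by (cases "x 0 = p - 1") (auto simp: padic_one_def)
  next
    case False
    with Suc have IH: "carry p x padic_one k = (if \<forall>i<k. x i = p - 1 then 1 else 0)" by simp
    show ?thesis
      using xk assms False
      by (cases "x k = p - 1") (auto simp: IH padic_one_def[THEN fun_cong, of k] less_Suc_eq)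
  qed
qed simp

text \<open>The vacuous condition at position 0 accounts for the digit of \<open>padic_one\<close>,
  so one formula covers all positions.\<close>

lemma S_nth:
  assumes "x \<in> padics p" "p \<ge> 2"
  shows "S p x k = (if \<forall>i<k. x i = p - 1 then (x k + 1) mod p else x k)"
proof (cases "k = 0")
  case False
  have "x k < p" using assms by (auto simp: padics_def)
  then show ?thesis
    using False assms
    by (auto simp: S_def padic_add_def carry_one padic_one_def[THEN fun_cong, of k])
qed (simp add: S_def padic_add_def padic_one_def)

lemma causal_S: "p \<ge> 2 \<Longrightarrow> causal p (S p)"
  unfolding causal_def
proof safe
  fix x :: "nat \<Rightarrow> nat" assume "x \<in> padics p" "p \<ge> 2"
  then show "S p x \<in> padics p" by (auto simp: S_def padic_add_def padics_def)
next
  fix x y :: "nat \<Rightarrow> nat" and n k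
  assume *: "p \<ge> 2" "x \<in> padics p" "y \<in> padics p" "\<forall>k<n. x k = y k" "k < n"
  then have "(\<forall>i<k. x i = p - 1) \<longleftrightarrow> (\<forall>i<k. y i = p - 1)" by auto
  with * show "S p x k = S p y k" by (simp only: S_nth)
qed

text \<open>Both sides say that x = -1 modulo p^k.\<close>

lemma S_prefix_zero_iff:
  assumes "x \<in> padics p" "p \<ge> 2"
  shows "(\<forall>i<k. S p x i = 0) \<longleftrightarrow> (\<forall>i<k. x i = p - 1)"
proof (induction k)
  case (Suc k)
  have "x k < p" using assms by (auto simp: padics_def)
  then have "(x k + 1) mod p = 0 \<longleftrightarrow> x k = p - 1"
    using assms by (cases "x k + 1 = p") auto
  then have "(\<forall>i<k. x i = p - 1) \<Longrightarrow> S p x k = 0 \<longleftrightarrow> x k = p - 1"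
    by (subst S_nth[OF assms], subst if_P) assumption+
  with Suc show ?case by (metis less_Suc_eq)
qed simp

text \<open>In the group this is (-(x+1)-1)+1 = -x-1: the complement conjugates \<open>S\<close> to
  its inverse. Digitwise, both applications of \<open>S\<close> change position k under the same
  condition on the lower digits of \<open>x\<close>.\<close>

lemma S_complement_S:
  assumes "x \<in> padics p" "p \<ge> 2"
  shows "S p (complement p (S p x)) = complement p x"
proof
  fix k
  have Sx: "S p x \<in> padics p" by (rule causal_closed[OF causal_S[OF assms(2)] assms(1)])
  then have cSx: "complement p (S p x) \<in> padics p"
    using assms(2) by (intro causal_closed[OF causal_complement Sx]) simp
  have "complement p (S p x) i = p - 1 \<longleftrightarrow> S p x i = 0" for i
    using Sx assms by (auto simp: complement_def padics_def)
  then have pre: "(\<forall>i<k. complement p (S p x) i = p - 1) \<longleftrightarrow> (\<forall>i<k. x i = p - 1)"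
    using S_prefix_zero_iff[OF assms] by simp
  have xk: "x k < p" using assms by (auto simp: padics_def)
  show "S p (complement p (S p x)) k = complement p x k"
    unfolding S_nth[OF cSx assms(2)] pre
    using xk assms by (cases "x k = p - 1") (auto simp: complement_def S_nth)
qed

text \<open>\<open>complement p (S p x)\<close> is -x-2. Leading digits p-1 become 0 under
  \<open>S\<close> and p-1 again under the complement; the first other digit is raised by 1 without
  overflow and then complemented. The bound makes the truncated subtraction exact.\<close>

lemma phi_complement_S:
  assumes "x \<in> padics' p" "p \<ge> 2"
  shows "complement p (S p x) \<in> padics' p"
    and "phi p (complement p (S p x)) = p - 2 - phi p x"
    and "phi p x \<le> p - 2"
proof -
  have x: "x \<in> padics p" and "\<exists>i. x i \<noteq> p - 1"
    using assms by (auto simp: padics'_def)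
  define i where "i = (LEAST i. x i \<noteq> p - 1)"
  have xi: "x i \<noteq> p - 1"
    unfolding i_def using \<open>\<exists>i. x i \<noteq> p - 1\<close> by (rule LeastI_ex)
  have less: "x k = p - 1" if "k < i" for k
    using that not_less_Least unfolding i_def by blast
  have bnd: "x i < p - 1"
  proof -
    have "x i < p" using x by (simp add: padics_def)
    with xi show ?thesis by linarith
  qed
  let ?y = "complement p (S p x)"
  have y: "?y \<in> padics p"
    using assms(2) by (intro causal_closed[OF causal_complement causal_closed[OF causal_S x]]) auto
  have yi: "?y i = p - 2 - x i"
    using less bnd assms x by (auto simp: complement_def S_nth)
  have yless: "?y k = p - 1" if "k < i" for k
    using that less assms x by (auto simp: complement_def S_nth)
  have ne: "?y i \<noteq> p - 1" using yi assms by auto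
  then show "?y \<in> padics' p" using y by (auto simp: padics'_def fun_eq_iff)
  have "(LEAST k. ?y k \<noteq> p - 1) = i"
    using ne yless by (intro Least_equality) (auto intro: leI)
  then have "phi p ?y = ?y i" unfolding phi_def by simp
  moreover have "phi p x = x i" by (simp add: phi_def i_def)
  ultimately show "phi p ?y = p - 2 - phi p x" "phi p x \<le> p - 2"
    using yi bnd by linarith+
qed

section \<open>The reflection and its effect on \<open>phi_sum\<close>\<close>

text \<open>This is \<open>-x-m-1\<close>.\<close>

definition reflection :: "nat \<Rightarrow> nat \<Rightarrow> (nat \<Rightarrow> nat) \<Rightarrow> (nat \<Rightarrow> nat)" where
  "reflection p m x = complement p ((S p ^^ m) x)"

lemma causal_reflection: "p \<ge> 2 \<Longrightarrow> causal p (reflection p m)"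
  unfolding reflection_def[abs_def]
  by (rule causal_comp[OF causal_complement causal_funpow[OF causal_S]]) auto

text \<open>In the group, (-x-m-1)+k = -x-(m-k)-1; each induction step cancels one \<open>S\<close>
  by \<open>S_complement_S\<close>.\<close>

lemma S_funpow_reflection:
  assumes "x \<in> padics p" "p \<ge> 2" "k \<le> m"
  shows "(S p ^^ k) (reflection p m x) = reflection p (m - k) x"
  using \<open>k \<le> m\<close>
proof (induction k)
  case (Suc k)
  define l where "l = m - Suc k"
  have l: "m - k = Suc l" using Suc.prems by (simp add: l_def)
  have "(S p ^^ l) x \<in> padics p"
    by (rule causal_closed[OF causal_funpow[OF causal_S[OF assms(2)]] assms(1)])
  then show ?case
    using Suc l S_complement_S[OF _ assms(2)] by (simp add: reflection_def l_def[symmetric])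
qed simp

text \<open>For k = m the preceding lemma leaves \<open>complement p x\<close>, which the outer
  complement undoes.\<close>

lemma reflection_involution:
  assumes "x \<in> padics p" "p \<ge> 2"
  shows "reflection p m (reflection p m x) = x"
  using S_funpow_reflection[OF assms, of m m] complement_complement[OF assms(1)]
  by (simp add: reflection_def)

text \<open>The orbit of the reflected point is the orbit of \<open>x\<close> run backwards, with
  each point y replaced by -y-2.\<close>

lemma phi_sum_reflection:
  assumes "x \<in> phi_sum_dom p m" "p \<ge> 2"
  shows "reflection p m x \<in> phi_sum_dom p m"
    and "phi_sum p m (reflection p m x) = m * (p - 2) - phi_sum p m x"
    and "phi_sum p m x \<le> m * (p - 2)"
proof -
  have dom: "(S p ^^ k) x \<in> padics' p" if "k < m" for k
    using assms that by (auto simp: phi_sum_dom_def)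
  have xp: "x \<in> padics p" using assms by (auto simp: phi_sum_dom_def)
  \<comment> \<open>One of the m-k applications of \<open>S\<close> is split off, to match the form
    \<open>complement p (S p y)\<close> of \<open>phi_complement_S\<close>.\<close>
  have step: "(S p ^^ k) (reflection p m x) = complement p (S p ((S p ^^ (m - Suc k)) x))" if "k < m" for k
  proof -
    have "m - k = Suc (m - Suc k)" using that by simp
    then show ?thesis
      using S_funpow_reflection[OF xp assms(2), of k m] that by (simp add: reflection_def)
  qed
  show "reflection p m x \<in> phi_sum_dom p m"
    using causal_closed[OF causal_reflection[OF assms(2)] xp] step
      phi_complement_S(1)[OF dom assms(2)]
    by (auto simp: phi_sum_dom_def)
  have le: "phi p ((S p ^^ k) x) \<le> p - 2" if "k < m" for k
    using phi_complement_S(3)[OF dom assms(2)] that by blast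
  show "phi_sum p m x \<le> m * (p - 2)"
    unfolding phi_sum_def using sum_bounded_above[of "{..<m}" "\<lambda>k. phi p ((S p ^^ k) x)" "p - 2"] le by auto
  have "phi_sum p m (reflection p m x) = (\<Sum>k<m. p - 2 - phi p ((S p ^^ (m - Suc k)) x))"
    unfolding phi_sum_def
    using step phi_complement_S(2)[OF dom assms(2)] by (intro sum.cong) auto
  also have "\<dots> = (\<Sum>k<m. p - 2 - phi p ((S p ^^ k) x))"
    by (rule sum.nat_diff_reindex)
  also have "\<dots> = (\<Sum>k<m. p - 2) - phi_sum p m x"
    unfolding phi_sum_def using le by (intro sum_subtractf_nat) auto
  finally show "phi_sum p m (reflection p m x) = m * (p - 2) - phi_sum p m x" by simp
qed

section \<open>Measurability and the almost sure domain\<close>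

lemma measurable_digit: "(\<lambda>x. x k) \<in> measurable (haar p) (count_space UNIV)"
proof (rule measurableI)
  fix A :: "nat set"
  have "{x \<in> padics p. x k \<in> A} \<in> sets (haar p)"
    unfolding sets_haar by (rule digit_in_sigma_cylinders)
  then show "(\<lambda>x. x k) -` A \<inter> space (haar p) \<in> sets (haar p)"
    by (simp add: space_haar vimage_def Int_def conj_commute)
qed auto

text \<open>The position read off is itself a measurable function with countably many values, so
  digit evaluation at it stays measurable.\<close>

lemma measurable_phi: "phi p \<in> measurable (haar p) (count_space UNIV)"
proof -
  note measurable_digit[measurable]
  have "(\<lambda>x. LEAST i. x i \<noteq> p - 1) \<in> measurable (haar p) (count_space UNIV)"
    by measurable
  from measurable_compose_countable[OF measurable_digit this] show ?thesis
    by (simp add: phi_def[abs_def])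
qed

lemma measurable_phi_sum:
  assumes "p \<ge> 2"
  shows "phi_sum p m \<in> measurable (haar p) (count_space UNIV)"
proof -
  have [measurable]: "(\<lambda>x. phi p ((S p ^^ k) x)) \<in> measurable (haar p) (count_space UNIV)" for k
    by (rule measurable_compose[OF measurable_causal[OF causal_funpow[OF causal_S[OF assms]]] measurable_phi])
  show ?thesis unfolding phi_sum_def[abs_def] by measurable
qed

lemma AE_phi_sum_dom:
  assumes "p \<ge> 2"
  shows "AE x in haar p. x \<in> phi_sum_dom p m"
proof -
  have "AE x in haar p. (S p ^^ k) x \<in> padics' p" for k
    \<comment> \<open>The only x with \<open>(S p ^^ k) x\<close> equal to the excluded point -1 is
      -k-1, obtained here by inverting the reflection.\<close>
    using AE_haar_neq[OF assms, of "reflection p k (complement p (\<lambda>_. p - 1))"] AE_space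
  proof eventually_elim
    case (elim x)
    then have "x \<in> padics p" by (simp add: space_haar)
    with elim show ?case
      using reflection_involution[of x p k] causal_closed[OF causal_funpow[OF causal_S], of p x k] assms
      by (auto simp: padics'_def reflection_def)
  qed
  then have "AE x in haar p. \<forall>k. (S p ^^ k) x \<in> padics' p"
    by (simp add: AE_all_countable)
  with AE_space show ?thesis
    by eventually_elim (auto simp: phi_sum_dom_def space_haar)
qed

lemma phi_sum_dom_sets:
  assumes "p \<ge> 2"
  shows "{x \<in> phi_sum_dom p m. int (phi_sum p m x) = j} \<in> sets (haar p)"
proof -
  note measurable_digit[measurable] measurable_phi_sum[OF assms, measurable]
  have [measurable]: "(\<lambda>x. (S p ^^ k) x i) \<in> measurable (haar p) (count_space UNIV)" for k i
    by (rule measurable_compose[OF measurable_causal[OF causal_funpow[OF causal_S[OF assms]]] measurable_digit])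
  \<comment> \<open>Avoiding the excluded point becomes a countable disjunction over digit
    positions.\<close>
  have "{x \<in> phi_sum_dom p m. int (phi_sum p m x) = j} =
      {x \<in> space (haar p). (\<forall>k\<in>{..<m}. \<exists>i. (S p ^^ k) x i \<noteq> p - 1) \<and> int (phi_sum p m x) = j}"
    using causal_closed[OF causal_funpow[OF causal_S[OF assms]]]
    by (auto simp: phi_sum_dom_def padics'_def space_haar fun_eq_iff)
  also have "\<dots> \<in> sets (haar p)" by measurable
  finally show ?thesis .
qed

section \<open>The generating function and the symmetry of its coefficients\<close>

theorem theorem3p3:
  fixes p m :: nat
  assumes "p \<ge> 3"
  shows "(\<forall>t::real. phi_gf p m t = (\<Sum>j = 0..m * (p - 2). phi_prob p m (int j) * t ^ j))
    \<and> (\<forall>j::int. 0 \<le> j \<and> j \<le> int m * (int p - 2) \<longrightarrow>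
          phi_prob p m j = phi_prob p m (int m * (int p - 2) - j))"
proof (intro conjI allI impI)
  have p: "p \<ge> 2" "p > 0" using assms by auto
  interpret prob_space "haar p" by (rule prob_space_haar) fact
  let ?A = "\<lambda>j. {x \<in> phi_sum_dom p m. int (phi_sum p m x) = j}"
  note A[measurable] = phi_sum_dom_sets[OF p(1), of m]
  note measurable_phi_sum[OF p(1), measurable]
  show "phi_gf p m t = (\<Sum>j = 0..m * (p - 2). phi_prob p m (int j) * t ^ j)" for t
  proof -
    \<comment> \<open>On the domain exactly one indicator is 1, as \<open>phi_sum\<close> is at most
      m(p-2); off the domain all vanish, so the integrands are compared almost everywhere.\<close>
    have "phi_gf p m t = (LINT x|haar p. (\<Sum>j = 0..m * (p - 2). indicator (?A (int j)) x * t ^ j))"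
      unfolding phi_gf_def
    proof (rule integral_cong_AE)
      show "AE x in haar p. t ^ phi_sum p m x
          = (\<Sum>j = 0..m * (p - 2). indicator (?A (int j)) x * t ^ j)"
        using AE_phi_sum_dom[OF p(1), of m]
      proof eventually_elim
        case (elim x)
        have "(\<Sum>j = 0..m * (p - 2). indicator (?A (int j)) x * t ^ j)
            = (\<Sum>j = 0..m * (p - 2). if j = phi_sum p m x then t ^ j else 0)"
          using elim by (intro sum.cong) auto
        then show ?case using phi_sum_reflection(3)[OF elim p(1)] by simp
      qed
    qed measurable
    also have "\<dots> = (\<Sum>j = 0..m * (p - 2). LINT x|haar p. indicator (?A (int j)) x * t ^ j)"
    proof (rule Bochner_Integration.integral_sum)
      have "integrable (haar p) (indicator (?A (int j)) :: _ \<Rightarrow> real)" for j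
        by (rule integrable_real_indicator[OF A]) (simp add: less_top[symmetric])
      then show "integrable (haar p) (\<lambda>x. indicator (?A (int j)) x * t ^ j)" for j
        by (rule integrable_mult_left)
    qed
    also have "\<dots> = (\<Sum>j = 0..m * (p - 2). phi_prob p m (int j) * t ^ j)"
      unfolding phi_prob_def integral_mult_left_zero
        Bochner_Integration.integral_indicator sets.Int_space_eq2[OF A] ..
    finally show ?thesis .
  qed
  fix j :: int assume "0 \<le> j \<and> j \<le> int m * (int p - 2)"
  let ?M = "int m * (int p - 2)"
  have M: "int (m * (p - 2)) = ?M" using p by (simp add: of_nat_diff)
  have refl: "reflection p m x \<in> ?A (?M - i)" if "x \<in> ?A i" for x i
    using that phi_sum_reflection[of x p m] p M by (auto simp: of_nat_diff)
  \<comment> \<open>\<open>refl\<close> gives one inclusion; applied to the reflected point with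
    \<open>?M - j\<close>, it gives the other by involutivity.\<close>
  have eq: "reflection p m -` ?A (?M - j) \<inter> space (haar p) = ?A j"
  proof (intro set_eqI iffI)
    fix x assume "x \<in> reflection p m -` ?A (?M - j) \<inter> space (haar p)"
    then show "x \<in> ?A j"
      using refl[of "reflection p m x" "?M - j"] reflection_involution[of x p m] p
      by (simp add: space_haar)
  next
    fix x assume "x \<in> ?A j"
    then show "x \<in> reflection p m -` ?A (?M - j) \<inter> space (haar p)"
      using refl[of x j] by (simp add: space_haar phi_sum_dom_def)
  qed
  \<comment> \<open>By invariance the measure may be replaced by its image under the reflection,
    which turns the event into its preimage \<open>?A j\<close>.\<close>
  have "phi_prob p m (?M - j) = measure (distr (haar p) (haar p) (reflection p m)) (?A (?M - j))"
    using distr_haar_causal_involution[OF p(2) causal_reflection[OF p(1)] reflection_involution[OF _ p(1)]]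
    by (simp add: phi_prob_def)
  also have "\<dots> = phi_prob p m j"
    using measure_distr[OF measurable_causal[OF causal_reflection[OF p(1)]] A] eq
    by (simp add: phi_prob_def)
  finally show "phi_prob p m j = phi_prob p m (?M - j)" ..
qed

end
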